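(* Let $A:\mathbb{X}^\star\to\{C^0\prec\dots\prec C^{p-1}\}$ be an assignment. The assignment $A$ can be represented in the model U-NCS if, and only if, $\phi^{SAT}_A$ is satisfiable. Here "$A$ can be represented in the model U-NCS" means that there exist a sequence of limiting profiles $\langle b\rangle=(b^1,\dots,b^{p-1})$ in $\mathbb{X}$ that is non-decreasing for weak dominance and an upset $\mathcal{T}$ of coalitions of criteria such that $\text{U-NCS}_{(\langle b\rangle,\mathcal{T})}$ extends $A$.
   Context: Setting. $\mathcal{N}$ is a finite set of criteria; for each $i\in\mathcal{N}$, $(\mathbb{X}_i,\le_i)$ is a totally ordered set; $\mathbb{X}=\prod_{i\in\mathcal{N}}\mathbb{X}_i$ is the set of profiles. A coalition is a subset of $\mathcal{N}$; an upset of coalitions is a family $\mathcal{T}\subseteq 2^{\mathcal{N}}$ such that $B\in\mathcal{T}$ and $B\subseteq B'\subseteq\mathcal{N}$ imply $B'\in\mathcal{T}$. For profiles $x,y$, $O_{\mathcal{N}}(x,y)=\{i\in\mathcal{N}: x_i\ge_i y_i\}$; $x$ weakly dominates $y$ when $O_{\mathcal{N}}(x,y)=\mathcal{N}$. There are $p$ ordered categories $C^0\prec C^1\prec\dots\prec C^{p-1}$; the limiting profile (frontier) $b^h$, $1\le h\le p-1$, separates $C^{h-1}$ from $C^h$. A sequence $(b^1,\dots,b^{p-1})$ in $\mathbb{X}$ is non-decreasing for weak dominance if $b^1_i\le_i\dots\le_i b^{p-1}_i$ for all $i\in\mathcal{N}$. U-NCS. For a sequence $\langle b\rangle=(b^1,\dots,b^{p-1})$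 of elements of $\mathbb{X}$ that is non-decreasing for weak dominance, and an upset of coalitions $\mathcal{T}$, the sorting function $\text{U-NCS}_{(\langle b\rangle,\mathcal{T})}$ maps a profile $x\in\mathbb{X}$ to the category $C^k$ ($0\le k\le p-1$) such that $O_{\mathcal{N}}(x,b^k)\in\mathcal{T}$ and $O_{\mathcal{N}}(x,b^{k+1})\notin\mathcal{T}$, where by convention the first condition is regarded as always true for $k=0$ and the second as always true for $k=p-1$. Assignment. $\mathbb{X}^\star\subset\mathbb{X}$ is a finite set of reference alternatives, $\mathbb{X}^\star_i=\{x_i:x\in\mathbb{X}^\star\}$, and an assignment $A$ is a function from $\mathbb{X}^\star$ to the set of categories. A sorting function extends $A$ if it coincides with $A$ on $\mathbb{X}^\star$. SAT encoding. $\phi^{SAT}_A$ is the Boolean function of the variables $x_{i,h,k}$ ($i\in\mathcal{N}$, $1\le h\le p-1$, $k\in\mathbb{X}^\star_i$) and $y_B$ ($B\subseteq\mathcal{N}$) given by the conjunction of the following clauses (an empty disjunction is false): (1) for all $i\in\mathcal{N}$, $1\le h\le p-1$, $k<k'$ in $\mathbb{X}^\star_i$: $x_{i,h,k'}\vee\neg x_{i,h,k}$; (2) for all $i\in\mathcal{N}$, $1\le h<h'\le p-1$, $k\in\mathbb{X}^\star_i$: $x_{i,h,k}\vee\neg x_{i,h',k}$; (3) for all $B\subset B'\subseteq\mathcal{N}$: $y_{B'}\vee\neg y_B$; (4) for all $B\subseteq\mathcal{N}$, $1\le h\le p-1$, $u\in\mathbb{X}^\star$ with $A(u)=C^{h-1}$: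 $(\bigvee_{i\in B}\neg x_{i,h,u_i})\vee\neg y_B$; (5) for all $B\subseteq\mathcal{N}$, $1\le h\le p-1$, $a\in\mathbb{X}^\star$ with $A(a)=C^{h}$: $(\bigvee_{i\in B}x_{i,h,a_i})\vee y_{\mathcal{N}\setminus B}$. It is satisfiable if some $0/1$ assignment of the variables makes it equal to $1$.
   Formalization: Each X_i is assumed nonempty, and for p ≥ 3 the direction from satisfiable to representable assumes each X_i has an element strictly above all reference values; without it the claim fails (one criterion, X = X* = {0<1}, p = 3, 0 in C^0, 1 in C^1). *)

theory Defs
  imports "HOL-Library.FuncSet"
begin

section \<open>Profiles, coalitions and dominance\<close>

text \<open>
  The criteria form a set \<open>N\<close>; criterion \<open>i\<close> takes its values in the set \<open>X i\<close>, totally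
  ordered by the relation \<open>le i\<close>. The sets \<open>X i\<close> share the ambient type \<open>'v\<close> but their orders
  are unrelated. The set of profiles is \<open>Pi\<^sub>E N X\<close>.
\<close>

definition outranking ::
  "'i set \<Rightarrow> ('i \<Rightarrow> 'v rel) \<Rightarrow> ('i \<Rightarrow> 'v) \<Rightarrow> ('i \<Rightarrow> 'v) \<Rightarrow> 'i set" where
  "outranking N le x y = {i \<in> N. (y i, x i) \<in> le i}"

definition weakly_dominates ::
  "'i set \<Rightarrow> ('i \<Rightarrow> 'v rel) \<Rightarrow> ('i \<Rightarrow> 'v) \<Rightarrow> ('i \<Rightarrow> 'v) \<Rightarrow> bool" where
  "weakly_dominates N le x y \<longleftrightarrow> outranking N le x y = N"

definition upset :: "'i set \<Rightarrow> 'i set set \<Rightarrow> bool" where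
  "upset N T \<longleftrightarrow> T \<subseteq> Pow N \<and> (\<forall>B\<in>T. \<forall>B'. B \<subseteq> B' \<and> B' \<subseteq> N \<longrightarrow> B' \<in> T)"


section \<open>The model U-NCS\<close>

text \<open>
  The category \<open>C\<^sup>k\<close> is encoded by its index \<open>k < p\<close>. A sequence of limiting profiles is a
  function on \<open>nat\<close>, of which only the values at \<open>1, \<dots>, p - 1\<close> matter.
\<close>

definition limiting_profiles ::
  "'i set \<Rightarrow> ('i \<Rightarrow> 'v set) \<Rightarrow> ('i \<Rightarrow> 'v rel) \<Rightarrow> nat \<Rightarrow> (nat \<Rightarrow> 'i \<Rightarrow> 'v) \<Rightarrow> bool" where
  "limiting_profiles N X le p b \<longleftrightarrow>
     (\<forall>h\<in>{1..<p}. b h \<in> Pi\<^sub>E N X) \<and>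
     monotone_on {1..<p} (\<le>) (\<lambda>x y. weakly_dominates N le y x) b"

definition u_ncs ::
  "'i set \<Rightarrow> ('i \<Rightarrow> 'v rel) \<Rightarrow> nat \<Rightarrow> (nat \<Rightarrow> 'i \<Rightarrow> 'v) \<Rightarrow> 'i set set \<Rightarrow> ('i \<Rightarrow> 'v) \<Rightarrow> nat" where
  "u_ncs N le p b T x =
     (THE k. k < p \<and>
        (k = 0 \<or> outranking N le x (b k) \<in> T) \<and>
        (k = p - 1 \<or> outranking N le x (b (k + 1)) \<notin> T))"

definition u_ncs_representable ::
  "'i set \<Rightarrow> ('i \<Rightarrow> 'v set) \<Rightarrow> ('i \<Rightarrow> 'v rel) \<Rightarrow> nat \<Rightarrow> ('i \<Rightarrow> 'v) set \<Rightarrow> (('i \<Rightarrow> 'v) \<Rightarrow> nat) \<Rightarrow> bool"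
  where
  "u_ncs_representable N X le p Xs A \<longleftrightarrow>
     (\<exists>b T. limiting_profiles N X le p b \<and> upset N T \<and> (\<forall>u\<in>Xs. u_ncs N le p b T u = A u))"


section \<open>The SAT encoding\<close>

text \<open>
  Clauses are sets of literals and a formula in conjunctive normal form is a set of clauses.
\<close>

datatype 'a literal = Pos 'a | Neg 'a

fun literal_true :: "('a \<Rightarrow> bool) \<Rightarrow> 'a literal \<Rightarrow> bool" where
  "literal_true v (Pos a) \<longleftrightarrow> v a"
| "literal_true v (Neg a) \<longleftrightarrow> \<not> v a"

definition satisfiable :: "'a literal set set \<Rightarrow> bool" where
  "satisfiable F \<longleftrightarrow> (\<exists>v. \<forall>C\<in>F. \<exists>l\<in>C. literal_true v l)"

datatype ('i, 'v) sat_var = XVar 'i nat 'v | YVar "'i set"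

definition phi_sat ::
  "'i set \<Rightarrow> ('i \<Rightarrow> 'v rel) \<Rightarrow> nat \<Rightarrow> ('i \<Rightarrow> 'v) set \<Rightarrow> (('i \<Rightarrow> 'v) \<Rightarrow> nat)
     \<Rightarrow> ('i, 'v) sat_var literal set set" where
  "phi_sat N le p Xs A =
     {{Pos (XVar i h k'), Neg (XVar i h k)} | i h k k'.
        i \<in> N \<and> h \<in> {1..<p} \<and> k \<in> (\<lambda>u. u i) ` Xs \<and> k' \<in> (\<lambda>u. u i) ` Xs \<and>
        (k, k') \<in> le i \<and> k \<noteq> k'} \<union>
     {{Pos (XVar i h k), Neg (XVar i h' k)} | i h h' k.
        i \<in> N \<and> h \<in> {1..<p} \<and> h' \<in> {1..<p} \<and> h < h' \<and> k \<in> (\<lambda>u. u i) ` Xs} \<union>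
     {{Pos (YVar B'), Neg (YVar B)} | B B'. B \<subset> B' \<and> B' \<subseteq> N} \<union>
     {{Neg (XVar i h (u i)) | i. i \<in> B} \<union> {Neg (YVar B)} | B h u.
        B \<subseteq> N \<and> h \<in> {1..<p} \<and> u \<in> Xs \<and> A u = h - 1} \<union>
     {{Pos (XVar i h (a i)) | i. i \<in> B} \<union> {Pos (YVar (N - B))} | B h a.
        B \<subseteq> N \<and> h \<in> {1..<p} \<and> a \<in> Xs \<and> A a = h}"


section \<open>Room for the limiting profiles\<close>

text \<open>
  A model of the formula may falsify \<open>XVar i h k\<close> for every reference value \<open>k\<close>, which calls for
  a limiting value strictly above all of them. If \<open>X i\<close> has no such element, satisfiability need
  not imply representability when \<open>p \<ge> 3\<close>: take \<open>N = {i}\<close>, \<open>X i = {0, 1}\<close> with \<open>0 < 1\<close>, both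
  profiles as reference alternatives, \<open>p = 3\<close> and the assignment \<open>0 \<mapsto> C\<^sup>0\<close>, \<open>1 \<mapsto> C\<^sup>1\<close>.
\<close>

definition headroom ::
  "'i set \<Rightarrow> ('i \<Rightarrow> 'v set) \<Rightarrow> ('i \<Rightarrow> 'v rel) \<Rightarrow> ('i \<Rightarrow> 'v) set \<Rightarrow> bool" where
  "headroom N X le Xs \<longleftrightarrow> (\<forall>i\<in>N. \<exists>t\<in>X i. \<forall>u\<in>Xs. (u i, t) \<in> le i \<and> u i \<noteq> t)"

end

theory Submission
  imports Defs
begin

text \<open>
  A representation yields a model of the formula by reading \<open>XVar i h k\<close> as
  \<open>b\<^sup>h\<^sub>i \<le>\<^sub>i k\<close> and \<open>YVar B\<close> as \<open>B \<in> T\<close>. Conversely, \<open>b\<^sup>h\<^sub>i\<close> is the least reference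
  value \<open>k\<close> making \<open>XVar i h k\<close> true, or a value above all reference values if there is none.
  Without such a value, at most one frontier matters (\<open>p \<le> 2\<close>): a criterion all of whose
  variables are false never contributes to a coalition, so \<open>T\<close> may ignore it, and the limiting
  value can be arbitrary on it.
\<close>

section \<open>Semantic form of the SAT encoding\<close>

text \<open>The five clause families read as implications, for a valuation split into
  \<open>x\<close> and \<open>y\<close>. Reference values appear as \<open>u i\<close> with
  \<open>u\<close> in \<open>Xs\<close>, and the first conjunct admits equal values, where it is
  trivial.\<close>

definition sat_model ::
  "'i set \<Rightarrow> ('i \<Rightarrow> 'v rel) \<Rightarrow> nat \<Rightarrow> ('i \<Rightarrow> 'v) set \<Rightarrow> (('i \<Rightarrow> 'v) \<Rightarrow> nat)
     \<Rightarrow> ('i \<Rightarrow> nat \<Rightarrow> 'v \<Rightarrow> bool) \<Rightarrow> ('i set \<Rightarrow> bool) \<Rightarrow> bool" where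
  "sat_model N le p Xs A x y \<longleftrightarrow>
    (\<forall>i\<in>N. \<forall>h\<in>{1..<p}. \<forall>u\<in>Xs. \<forall>u'\<in>Xs. (u i, u' i) \<in> le i \<and> x i h (u i) \<longrightarrow> x i h (u' i)) \<and>
    (\<forall>i\<in>N. \<forall>h\<in>{1..<p}. \<forall>h'\<in>{1..<p}. \<forall>u\<in>Xs. h < h' \<and> x i h' (u i) \<longrightarrow> x i h (u i)) \<and>
    (\<forall>B B'. B \<subset> B' \<and> B' \<subseteq> N \<and> y B \<longrightarrow> y B') \<and>
    (\<forall>B\<subseteq>N. \<forall>h\<in>{1..<p}. \<forall>u\<in>Xs. A u = h - 1 \<and> y B \<longrightarrow> (\<exists>i\<in>B. \<not> x i h (u i))) \<and>
    (\<forall>B\<subseteq>N. \<forall>h\<in>{1..<p}. \<forall>a\<in>Xs. A a = h \<and> \<not> y (N - B) \<longrightarrow> (\<exists>i\<in>B. x i h (a i)))"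

lemma sat_modelD:
  assumes "sat_model N le p Xs A x y"
  shows sat_model_up: "\<lbrakk>i \<in> N; h \<in> {1..<p}; u \<in> Xs; u' \<in> Xs; (u i, u' i) \<in> le i; x i h (u i)\<rbrakk>
      \<Longrightarrow> x i h (u' i)"
    and sat_model_down: "\<lbrakk>i \<in> N; h \<in> {1..<p}; h' \<in> {1..<p}; u \<in> Xs; h < h'; x i h' (u i)\<rbrakk>
      \<Longrightarrow> x i h (u i)"
    and sat_model_mono: "\<lbrakk>B \<subset> B'; B' \<subseteq> N; y B\<rbrakk> \<Longrightarrow> y B'"
    and sat_model_below: "\<lbrakk>B \<subseteq> N; h \<in> {1..<p}; u \<in> Xs; A u = h - 1; y B\<rbrakk>
      \<Longrightarrow> \<exists>i\<in>B. \<not> x i h (u i)"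
    and sat_model_above: "\<lbrakk>B \<subseteq> N; h \<in> {1..<p}; a \<in> Xs; A a = h; \<not> y (N - B)\<rbrakk>
      \<Longrightarrow> \<exists>i\<in>B. x i h (a i)"
proof -
  note P = assms[unfolded sat_model_def]
  note 1 = P[THEN conjunct1] and P2 = P[THEN conjunct2]
  note 2 = P2[THEN conjunct1] and P3 = P2[THEN conjunct2]
  note 3 = P3[THEN conjunct1] and P4 = P3[THEN conjunct2]
  note 4 = P4[THEN conjunct1] and 5 = P4[THEN conjunct2]
  show "\<lbrakk>i \<in> N; h \<in> {1..<p}; u \<in> Xs; u' \<in> Xs; (u i, u' i) \<in> le i; x i h (u i)\<rbrakk>
      \<Longrightarrow> x i h (u' i)"
    using 1 by blast
  show "\<lbrakk>i \<in> N; h \<in> {1..<p}; h' \<in> {1..<p}; u \<in> Xs; h < h'; x i h' (u i)\<rbrakk> \<Longrightarrow> x i h (u i)"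
    using 2 by blast
  show "\<lbrakk>B \<subset> B'; B' \<subseteq> N; y B\<rbrakk> \<Longrightarrow> y B'"
    using 3 by blast
  show "\<lbrakk>B \<subseteq> N; h \<in> {1..<p}; u \<in> Xs; A u = h - 1; y B\<rbrakk> \<Longrightarrow> \<exists>i\<in>B. \<not> x i h (u i)"
    using 4 by blast
  show "\<lbrakk>B \<subseteq> N; h \<in> {1..<p}; a \<in> Xs; A a = h; \<not> y (N - B)\<rbrakk> \<Longrightarrow> \<exists>i\<in>B. x i h (a i)"
    using 5 by blast
qed

text \<open>A valuation of \<open>sat_var\<close> amounts to one valuation per constructor, and a
  clause has a true literal exactly when the corresponding implication holds.\<close>

lemma satisfiable_phi_sat_iff:
  "satisfiable (phi_sat N le p Xs A) \<longleftrightarrow> (\<exists>x y. sat_model N le p Xs A x y)"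
proof
  assume "satisfiable (phi_sat N le p Xs A)"
  then obtain v where v: "\<And>C. C \<in> phi_sat N le p Xs A \<Longrightarrow> \<exists>l\<in>C. literal_true v l"
    unfolding satisfiable_def by blast
  define x where "x = (\<lambda>i h k. v (XVar i h k))"
  define y where "y = (\<lambda>B. v (YVar B))"
  have "sat_model N le p Xs A x y"
    unfolding sat_model_def
  proof (intro conjI ballI allI impI)
    fix i h u u'
    assume *: "i \<in> N" "h \<in> {1..<p}" "u \<in> Xs" "u' \<in> Xs" "(u i, u' i) \<in> le i \<and> x i h (u i)"
    show "x i h (u' i)"
    \<comment> \<open>The formula has a clause only for distinct values.\<close>
    proof (cases "u i = u' i")
      case False
      have "{Pos (XVar i h (u' i)), Neg (XVar i h (u i))} \<in> phi_sat N le p Xs A"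
        unfolding phi_sat_def
        by (insert * False, rule UnI1, rule UnI1, rule UnI1, rule UnI1,
            intro CollectI exI conjI, rule refl) auto
      from v[OF this] show ?thesis using * by (simp add: x_def)
    qed (use * in simp)
  next
    fix i h h' u
    assume *: "i \<in> N" "h \<in> {1..<p}" "h' \<in> {1..<p}" "u \<in> Xs" "h < h' \<and> x i h' (u i)"
    have "{Pos (XVar i h (u i)), Neg (XVar i h' (u i))} \<in> phi_sat N le p Xs A"
      unfolding phi_sat_def
      by (insert *, rule UnI1, rule UnI1, rule UnI1, rule UnI2,
          intro CollectI exI conjI, rule refl) auto
    from v[OF this] show "x i h (u i)" using * by (simp add: x_def)
  next
    fix B B'
    assume *: "B \<subset> B' \<and> B' \<subseteq> N \<and> y B"
    have "{Pos (YVar B'), Neg (YVar B)} \<in> phi_sat N le p Xs A"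
      unfolding phi_sat_def
      by (insert *, rule UnI1, rule UnI1, rule UnI2,
          intro CollectI exI conjI, rule refl) auto
    from v[OF this] show "y B'" using * by (simp add: y_def)
  next
    fix B h u
    assume *: "B \<subseteq> N" "h \<in> {1..<p}" "u \<in> Xs" "A u = h - 1 \<and> y B"
    have "{Neg (XVar i h (u i)) | i. i \<in> B} \<union> {Neg (YVar B)} \<in> phi_sat N le p Xs A"
      unfolding phi_sat_def
      by (insert *, rule UnI1, rule UnI2,
          intro CollectI exI conjI, rule refl) auto
    from v[OF this] show "\<exists>i\<in>B. \<not> x i h (u i)" using * by (auto simp: x_def y_def)
  next
    fix B h a
    assume *: "B \<subseteq> N" "h \<in> {1..<p}" "a \<in> Xs" "A a = h \<and> \<not> y (N - B)"
    have "{Pos (XVar i h (a i)) | i. i \<in> B} \<union> {Pos (YVar (N - B))} \<in> phi_sat N le p Xs A"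
      unfolding phi_sat_def
      by (insert *, rule UnI2,
          intro CollectI exI conjI, rule refl) auto
    from v[OF this] show "\<exists>i\<in>B. x i h (a i)" using * by (auto simp: x_def y_def)
  qed
  then show "\<exists>x y. sat_model N le p Xs A x y" by blast
next
  assume "\<exists>x y. sat_model N le p Xs A x y"
  then obtain x y where model: "sat_model N le p Xs A x y" by blast
  define v where "v = (\<lambda>w. case w of XVar i h k \<Rightarrow> x i h k | YVar B \<Rightarrow> y B)"
  have v: "v (XVar i h k) = x i h k" "v (YVar B) = y B" for i h k B
    by (simp_all add: v_def)
  have "\<exists>l\<in>C. literal_true v l" if "C \<in> phi_sat N le p Xs A" for C
    using that unfolding phi_sat_def
  proof (elim UnE CollectE exE conjE)
    fix i h k k'
    assume "C = {Pos (XVar i h k'), Neg (XVar i h k)}" "i \<in> N" "h \<in> {1..<p}"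
      "k \<in> (\<lambda>u. u i) ` Xs" "k' \<in> (\<lambda>u. u i) ` Xs" "(k, k') \<in> le i"
    moreover from this obtain u u' where "u \<in> Xs" "u' \<in> Xs" "k = u i" "k' = u' i" by blast
    ultimately show ?thesis using sat_model_up[OF model, of i h u u']
      by (auto simp: v)
  next
    fix i h h' k
    assume "C = {Pos (XVar i h k), Neg (XVar i h' k)}" "i \<in> N" "h \<in> {1..<p}" "h' \<in> {1..<p}"
      "h < h'" "k \<in> (\<lambda>u. u i) ` Xs"
    moreover from this obtain u where "u \<in> Xs" "k = u i" by blast
    ultimately show ?thesis using sat_model_down[OF model, of i h h' u]
      by (auto simp: v)
  next
    fix B B'
    assume "C = {Pos (YVar B'), Neg (YVar B)}" "B \<subset> B'" "B' \<subseteq> N"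
    then show ?thesis using sat_model_mono[OF model, of B B']
      by (auto simp: v)
  next
    fix B h u
    assume C: "C = {Neg (XVar i h (u i)) | i. i \<in> B} \<union> {Neg (YVar B)}"
      and *: "B \<subseteq> N" "h \<in> {1..<p}" "u \<in> Xs" "A u = h - 1"
    show ?thesis
    proof (cases "y B")
      case True
      then obtain i where "i \<in> B" "\<not> x i h (u i)"
        using sat_model_below[OF model, of B h u] * by blast
      then show ?thesis unfolding C by (intro bexI[of _ "Neg (XVar i h (u i))"]) (auto simp: v)
    qed (simp add: C v)
  next
    fix B h a
    assume C: "C = {Pos (XVar i h (a i)) | i. i \<in> B} \<union> {Pos (YVar (N - B))}"
      and *: "B \<subseteq> N" "h \<in> {1..<p}" "a \<in> Xs" "A a = h"
    show ?thesis
    proof (cases "y (N - B)")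
      case False
      then obtain i where "i \<in> B" "x i h (a i)"
        using sat_model_above[OF model, of B h a] * by blast
      then show ?thesis unfolding C by (intro bexI[of _ "Pos (XVar i h (a i))"]) (auto simp: v)
    qed (simp add: C v)
  qed
  then show "satisfiable (phi_sat N le p Xs A)" unfolding satisfiable_def by blast
qed

section \<open>Well-definedness of the sorting function\<close>

lemma limiting_profiles_mono:
  assumes "limiting_profiles N X le p b" "h \<in> {1..<p}" "h' \<in> {1..<p}" "h \<le> h'" "i \<in> N"
  shows "(b h i, b h' i) \<in> le i"
  using assms unfolding limiting_profiles_def monotone_on_def weakly_dominates_def outranking_def
  by blast

text \<open>By transitivity, a criterion that reaches a higher frontier also reaches every lower
  one.\<close>

lemma outranking_antimono:
  assumes "\<And>i. i \<in> N \<Longrightarrow> trans (le i)" "limiting_profiles N X le p b"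
    and "h \<in> {1..<p}" "h' \<in> {1..<p}" "h \<le> h'"
  shows "outranking N le x (b h') \<subseteq> outranking N le x (b h)"
  using limiting_profiles_mono[OF assms(2-5)] assms(1)
  unfolding outranking_def by (blast dest: transD)

text \<open>The outranking coalitions shrink as the frontier rises, so they belong to
  \<open>T\<close> up to some index and to its complement afterwards. Exactly one category therefore
  meets both conditions, and the definite description in \<open>u_ncs\<close> can be
  unfolded.\<close>

lemma u_ncs_eq_iff:
  assumes tr: "\<And>i. i \<in> N \<Longrightarrow> trans (le i)" and lp: "limiting_profiles N X le p b"
    and T: "upset N T" and k: "k < p"
  shows "u_ncs N le p b T x = k \<longleftrightarrow>
    (k = 0 \<or> outranking N le x (b k) \<in> T) \<and> (k = p - 1 \<or> outranking N le x (b (k + 1)) \<notin> T)"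
proof -
  define P where "P k \<longleftrightarrow> k < p \<and> (k = 0 \<or> outranking N le x (b k) \<in> T) \<and>
    (k = p - 1 \<or> outranking N le x (b (k + 1)) \<notin> T)" for k
  have down: "outranking N le x (b h) \<in> T"
    if "outranking N le x (b h') \<in> T" "h \<in> {1..<p}" "h' \<in> {1..<p}" "h \<le> h'" for h h'
  proof -
    have "outranking N le x (b h) \<subseteq> N" by (auto simp: outranking_def)
    then show ?thesis
      using T that(1) outranking_antimono[OF tr lp that(2-4)] unfolding upset_def by blast
  qed
  \<comment> \<open>Here \<open>k\<close> is positive, so the coalition at \<open>b k\<close> is in
    \<open>T\<close>. Since \<open>j + 1 \<le> k\<close>, so is the one at \<open>b (j + 1)\<close>,
    against the second condition for \<open>j\<close>, which is not void because
    \<open>j < p - 1\<close>.\<close>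
  have not_less: False if "P j" "P k" "j < k" for j k
    using that down[of k "j + 1"] unfolding P_def by auto
  have unique: "j = k" if "P j" "P k" for j k
    using not_less that by (metis linorder_neqE_nat)
  have "\<exists>k. P k"
  proof -
    \<comment> \<open>The category sought is the largest index satisfying the first condition;
      \<open>0\<close> always does, by convention. The successor of the maximum is either
      \<open>p\<close> or violates the condition.\<close>
    define S where "S = {k. k < p \<and> (k = 0 \<or> outranking N le x (b k) \<in> T)}"
    have "finite S" "0 \<in> S" using k by (auto simp: S_def)
    then have max: "Max S \<in> S" and ge: "\<And>j. j \<in> S \<Longrightarrow> j \<le> Max S"
      using Max_in[of S] Max_ge[of S] by blast+
    have "Max S + 1 \<notin> S" using ge by fastforce
    then have "P (Max S)" using max unfolding S_def P_def by auto
    then show ?thesis ..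
  qed
  then have "\<exists>!k. P k" using unique by blast
  then have "(THE k. P k) = k \<longleftrightarrow> P k" using theI'[of P] unique by blast
  then show ?thesis using k unfolding u_ncs_def P_def by simp
qed

section \<open>From a representation to a model\<close>

lemma satisfiable_if_representable:
  assumes tr: "\<And>i. i \<in> N \<Longrightarrow> trans (le i)" and A: "A \<in> Xs \<rightarrow> {..<p}"
    and rep: "u_ncs_representable N X le p Xs A"
  shows "satisfiable (phi_sat N le p Xs A)"
proof -
  obtain b T where lp: "limiting_profiles N X le p b" and T: "upset N T"
    and ext: "\<And>u. u \<in> Xs \<Longrightarrow> u_ncs N le p b T u = A u"
    using rep unfolding u_ncs_representable_def by blast
  have val: "(A u = 0 \<or> outranking N le u (b (A u)) \<in> T) \<and>
      (A u = p - 1 \<or> outranking N le u (b (A u + 1)) \<notin> T)" if "u \<in> Xs" for u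
    using u_ncs_eq_iff[OF tr lp T] ext[OF that] A that by blast
  have up: "B' \<in> T" if "B \<in> T" "B \<subseteq> B'" "B' \<subseteq> N" for B B'
    using T that unfolding upset_def by blast
  show ?thesis
    unfolding satisfiable_phi_sat_iff sat_model_def
  \<comment> \<open>The two valuations are left open here and fixed by the conditions shown:
    \<open>x i h k\<close> is \<open>(b h i, k) \<in> le i\<close> and \<open>y B\<close> is
    \<open>B \<in> T\<close>.\<close>
  proof (intro exI conjI)
    show "\<forall>i\<in>N. \<forall>h\<in>{1..<p}. \<forall>u\<in>Xs. \<forall>u'\<in>Xs.
        (u i, u' i) \<in> le i \<and> (b h i, u i) \<in> le i \<longrightarrow> (b h i, u' i) \<in> le i"
      using tr by (blast dest: transD)
    show "\<forall>i\<in>N. \<forall>h\<in>{1..<p}. \<forall>h'\<in>{1..<p}. \<forall>u\<in>Xs.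
        h < h' \<and> (b h' i, u i) \<in> le i \<longrightarrow> (b h i, u i) \<in> le i"
    proof (intro ballI impI)
      fix i h h' u
      assume *: "i \<in> N" "h \<in> {1..<p}" "h' \<in> {1..<p}" "h < h' \<and> (b h' i, u i) \<in> le i"
      then have "(b h i, b h' i) \<in> le i" using limiting_profiles_mono[OF lp, of h h' i] by simp
      then show "(b h i, u i) \<in> le i" using * transD[OF tr] by blast
    qed
    show "\<forall>B B'. B \<subset> B' \<and> B' \<subseteq> N \<and> B \<in> T \<longrightarrow> B' \<in> T"
      using up by blast
    show "\<forall>B\<subseteq>N. \<forall>h\<in>{1..<p}. \<forall>u\<in>Xs. A u = h - 1 \<and> B \<in> T \<longrightarrow> (\<exists>i\<in>B. (b h i, u i) \<notin> le i)"
    proof (intro allI ballI impI)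
      fix B h u
      assume *: "B \<subseteq> N" "h \<in> {1..<p}" "u \<in> Xs" "A u = h - 1 \<and> B \<in> T"
      \<comment> \<open>Since \<open>1 \<le> h < p\<close>, the category \<open>h - 1\<close> is not
        the last one and its upper frontier is \<open>b h\<close>. A member \<open>B\<close> of the
        upset \<open>T\<close> cannot lie inside a coalition outside \<open>T\<close>.\<close>
      then have "outranking N le u (b h) \<notin> T" using val[of u] by auto
      then have "\<not> B \<subseteq> outranking N le u (b h)"
        using up[of B "outranking N le u (b h)"] * by (auto simp: outranking_def)
      then show "\<exists>i\<in>B. (b h i, u i) \<notin> le i" using * by (auto simp: outranking_def)
    qed
    show "\<forall>B\<subseteq>N. \<forall>h\<in>{1..<p}. \<forall>a\<in>Xs. A a = h \<and> N - B \<notin> T \<longrightarrow> (\<exists>i\<in>B. (b h i, a i) \<in> le i)"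
    proof (intro allI ballI impI)
      fix B h a
      assume *: "B \<subseteq> N" "h \<in> {1..<p}" "a \<in> Xs" "A a = h \<and> N - B \<notin> T"
      then have "outranking N le a (b h) \<in> T" using val[of a] by auto
      \<comment> \<open>If the coalition avoided \<open>B\<close>, it would lie in
        \<open>N - B\<close> and force that set into \<open>T\<close>.\<close>
      then have "\<not> outranking N le a (b h) \<subseteq> N - B" using up[of _ "N - B"] * by blast
      then show "\<exists>i\<in>B. (b h i, a i) \<in> le i" by (auto simp: outranking_def)
    qed
  qed
qed

section \<open>From a model to a representation\<close>

text \<open>Provides the least reference value at which a variable is true; the new element is
  compared with the least one found so far.\<close>

lemma linear_order_on_finite_least:
  assumes "linear_order_on A r" "finite S" "S \<noteq> {}" "S \<subseteq> A"
  shows "\<exists>m\<in>S. \<forall>k\<in>S. (m, k) \<in> r"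
  using assms(2-4)
proof (induction S rule: finite_ne_induct)
  case (singleton a)
  then show ?case using assms(1) by (auto simp: order_on_defs refl_on_def)
next
  case (insert a S)
  then obtain m where m: "m \<in> S" "\<forall>k\<in>S. (m, k) \<in> r" by blast
  then have "m \<in> A" "a \<noteq> m" using insert.hyps insert.prems by auto
  then have *: "(a, a) \<in> r" "(a, m) \<in> r \<or> (m, a) \<in> r" "trans r"
    using assms(1) insert.prems
    by (auto simp: order_on_defs refl_on_def total_on_def)
  show ?case
  proof (cases "(a, m) \<in> r")
    case True
    then have "\<forall>k\<in>insert a S. (a, k) \<in> r" using m * by (auto dest: transD)
    then show ?thesis by blast
  qed (use m * in auto)
qed

text \<open>Taking least true values as thresholds turns the first clause family into an equivalence
  between variables and comparisons with the frontier, the second into monotonicity of the frontiers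
  and the third into the upset property. The last two then give the two conditions that characterise
  \<open>u_ncs\<close>.\<close>

lemma representable_if_satisfiable:
  assumes lin: "\<And>i. i \<in> N \<Longrightarrow> linear_order_on (X i) (le i)"
    and ne: "\<And>i. i \<in> N \<Longrightarrow> X i \<noteq> {}"
    and fin: "finite Xs" and Xs: "Xs \<subseteq> Pi\<^sub>E N X" and A: "A \<in> Xs \<rightarrow> {..<p}"
    and head: "p \<ge> 3 \<Longrightarrow> headroom N X le Xs"
    and sat: "satisfiable (phi_sat N le p Xs A)"
  shows "u_ncs_representable N X le p Xs A"
proof -
  have tr: "trans (le i)" if "i \<in> N" for i
    using lin[OF that] by (simp add: order_on_defs)
  obtain x y where model: "sat_model N le p Xs A x y"
    using sat unfolding satisfiable_phi_sat_iff by blast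
  note x_up = sat_model_up[OF model] and x_down = sat_model_down[OF model]
    and y_up = sat_model_mono[OF model]
    and below = sat_model_below[OF model] and above = sat_model_above[OF model]
  define S where "S h i = {k \<in> (\<lambda>u. u i) ` Xs. x i h k}" for h i
  have S_sub: "S h i \<subseteq> X i" if "i \<in> N" for h i
    using that Xs unfolding S_def by (auto dest: PiE_mem)
  \<comment> \<open>One choice serves both cases: \<open>t i\<close> lies strictly above all
    reference values if there is headroom, and is arbitrary in \<open>X i\<close> otherwise.\<close>
  have "\<forall>i\<in>N. \<exists>t\<in>X i. headroom N X le Xs \<longrightarrow> (\<forall>u\<in>Xs. (u i, t) \<in> le i \<and> u i \<noteq> t)"
    unfolding headroom_def using ne by blast
  then obtain t where t: "\<And>i. i \<in> N \<Longrightarrow> t i \<in> X i"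
    and t_top: "\<And>i u. \<lbrakk>headroom N X le Xs; i \<in> N; u \<in> Xs\<rbrakk> \<Longrightarrow> (u i, t i) \<in> le i \<and> u i \<noteq> t i"
    by metis
  \<comment> \<open>The threshold is the minimum of \<open>S h i\<close>, with \<open>t i\<close> as
    the default when no variable is true.\<close>
  have "\<forall>h. \<forall>i\<in>N. \<exists>m. (if S h i = {} then m = t i else m \<in> S h i \<and> (\<forall>k\<in>S h i. (m, k) \<in> le i))"
  proof (intro allI ballI)
    fix h i
    assume "i \<in> N"
    moreover have "finite (S h i)" using fin by (simp add: S_def)
    ultimately show
      "\<exists>m. (if S h i = {} then m = t i else m \<in> S h i \<and> (\<forall>k\<in>S h i. (m, k) \<in> le i))"
      using linear_order_on_finite_least[OF lin _ _ S_sub] by (cases "S h i = {}") auto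
  qed
  then obtain c where c: "\<And>h i. i \<in> N \<Longrightarrow>
      (if S h i = {} then c h i = t i else c h i \<in> S h i \<and> (\<forall>k\<in>S h i. (c h i, k) \<in> le i))"
    by metis
  have c_X: "c h i \<in> X i" if "i \<in> N" for h i
    using c[OF that, of h] t[OF that] S_sub[OF that] by (auto split: if_splits)
  have c_mono: "(c h i, c h' i) \<in> le i"
    if "i \<in> N" "h \<in> {1..<p}" "h' \<in> {1..<p}" "h \<le> h'" for h h' i
  proof (cases "h = h'")
    case True
    then show ?thesis using lin[OF that(1)] c_X[OF that(1)]
      by (auto simp: order_on_defs refl_on_def)
  next
    case False
    \<comment> \<open>Two distinct indices in \<open>{1..<p}\<close> force
      \<open>p \<ge> 3\<close>.\<close>
    then have "h < h'" and "headroom N X le Xs" using that head by auto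
    have sub: "S h' i \<subseteq> S h i"
      using x_down[OF that(1-3) _ \<open>h < h'\<close>] unfolding S_def by auto
    show ?thesis
    proof (cases "S h' i = {}")
      case True
      then have c': "c h' i = t i" using c[OF that(1), of h'] by simp
      show ?thesis
      proof (cases "S h i = {}")
        case True
        then show ?thesis using c' c[OF that(1), of h] lin[OF that(1)] t[OF that(1)]
          by (auto simp: order_on_defs refl_on_def)
      next
        case False
        then have "c h i \<in> S h i" using c[OF that(1), of h] by simp
        then have "c h i \<in> (\<lambda>u. u i) ` Xs" by (simp add: S_def)
        then show ?thesis using c' t_top[OF \<open>headroom N X le Xs\<close> that(1)] by auto
      qed
    next
      case False
      then have "S h i \<noteq> {}" using sub by blast
      then show ?thesis using False sub c[OF that(1), of h] c[OF that(1), of h'] by auto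
    qed
  qed
  define b where "b h = restrict (c h) N" for h
  \<comment> \<open>Without headroom the arbitrary default \<open>t i\<close> may lie below a
    reference value and put \<open>i\<close> into an outranking coalition although its variables are
    false. \<open>F\<close> collects these criteria, and \<open>T\<close> discards them before
    consulting \<open>y\<close>.\<close>
  define F where "F = (if headroom N X le Xs then {} else {i \<in> N. S 1 i = {}})"
  define T where "T = {B. B \<subseteq> N \<and> y (B - F)}"
  have lp: "limiting_profiles N X le p b"
    using c_X c_mono
    unfolding limiting_profiles_def monotone_on_def weakly_dominates_def outranking_def b_def
    by auto
  have T: "upset N T"
    unfolding upset_def
  proof (intro conjI ballI allI impI)
    fix B B'
    assume "B \<in> T" "B \<subseteq> B' \<and> B' \<subseteq> N"
    \<comment> \<open>\<open>y_up\<close> concerns strict inclusions, so sets that differ only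
      within \<open>F\<close> form a separate case.\<close>
    then show "B' \<in> T"
      using y_up[of "B - F" "B' - F"] unfolding T_def by (cases "B - F = B' - F") auto
  qed (auto simp: T_def)
  \<comment> \<open>The key identity: outside \<open>F\<close>, reaching the frontier means having a
    true variable, while the variables of criteria in \<open>F\<close> are all false.\<close>
  have threshold: "outranking N le u (b h) - F = {i \<in> N. x i h (u i)}"
    if h: "h \<in> {1..<p}" and u: "u \<in> Xs" for h u
  proof -
    \<comment> \<open>Without headroom \<open>p \<le> 2\<close>, so \<open>b 1\<close> is the only
      frontier; hence the index \<open>1\<close> in the definition of \<open>F\<close>.\<close>
    have h1: "h = 1" if "\<not> headroom N X le Xs"
      using h head that by (cases "p \<ge> 3") auto
    have F_false: "\<not> x i h (u i)" if "i \<in> F" for i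
    proof
      assume "x i h (u i)"
      have "\<not> headroom N X le Xs" and "S 1 i = {}"
        using that by (auto simp: F_def split: if_splits)
      then show False using h1 \<open>S 1 i = {}\<close> \<open>x i h (u i)\<close> u by (auto simp: S_def)
    qed
    have "(c h i, u i) \<in> le i \<longleftrightarrow> x i h (u i)" if i: "i \<in> N" "i \<notin> F" for i
    proof
      assume "x i h (u i)"
      then have "u i \<in> S h i" using u by (simp add: S_def)
      then show "(c h i, u i) \<in> le i" using c[OF i(1), of h] by (auto split: if_splits)
    next
      assume le: "(c h i, u i) \<in> le i"
      show "x i h (u i)"
      proof (cases "S h i = {}")
        case True
        \<comment> \<open>As \<open>i\<close> is not in \<open>F\<close>, an empty
          \<open>S h i\<close> implies headroom. Then \<open>t i\<close> is strictly above
          \<open>u i\<close>, which contradicts \<open>le\<close> by antisymmetry.\<close>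
        have "headroom N X le Xs"
        proof (rule ccontr)
          assume nh: "\<not> headroom N X le Xs"
          then have "S 1 i = {}" using True h1[OF nh] by simp
          then show False using i nh by (simp add: F_def)
        qed
        then have "(u i, t i) \<in> le i" "u i \<noteq> t i" using t_top i(1) u by blast+
        moreover have "c h i = t i" using True c[OF i(1), of h] by simp
        moreover have "antisym (le i)" using lin[OF i(1)] by (simp add: order_on_defs)
        ultimately show ?thesis using le by (auto dest: antisymD)
      next
        case False
        then have "c h i \<in> S h i" using c[OF i(1), of h] by simp
        then show ?thesis using x_up[OF i(1) h _ u] le by (auto simp: S_def)
      qed
    qed
    then show ?thesis using F_false by (auto simp: outranking_def b_def)
  qed
  have "u_ncs N le p b T u = A u" if u: "u \<in> Xs" for u
  proof -
    have Au: "A u < p" using A u by blast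
    have "outranking N le u (b (A u)) \<in> T" if "A u \<noteq> 0"
    proof -
      have h: "A u \<in> {1..<p}" using that Au by simp
      \<comment> \<open>The fifth clause family for this \<open>B\<close> leaves only
        \<open>y (N - B)\<close>, since no criterion in \<open>B\<close> has a true
        variable.\<close>
      define B where "B = {i \<in> N. \<not> x i (A u) (u i)}"
      have "y (N - B)" using above[of B "A u" u] h u by (auto simp: B_def)
      moreover have "N - B = outranking N le u (b (A u)) - F"
        unfolding threshold[OF h u] B_def by blast
      ultimately show ?thesis by (auto simp: T_def outranking_def)
    qed
    moreover have "outranking N le u (b (A u + 1)) \<notin> T" if "A u \<noteq> p - 1"
    proof
      assume "outranking N le u (b (A u + 1)) \<in> T"
      have h: "A u + 1 \<in> {1..<p}" using that Au by simp
      have "y {i \<in> N. x i (A u + 1) (u i)}"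
        using \<open>_ \<in> T\<close> threshold[OF h u] by (simp add: T_def)
      \<comment> \<open>The fourth clause family demands a false variable within this coalition,
        where all are true.\<close>
      then show False using below[OF _ h u, of "{i \<in> N. x i (A u + 1) (u i)}"] by auto
    qed
    ultimately have "(A u = 0 \<or> outranking N le u (b (A u)) \<in> T) \<and>
        (A u = p - 1 \<or> outranking N le u (b (A u + 1)) \<notin> T)" by argo
    then show ?thesis by (subst u_ncs_eq_iff[OF tr lp T Au])
  qed
  then show ?thesis using lp T unfolding u_ncs_representable_def by blast
qed

theorem corollary2:
  fixes N :: "'i set" and X :: "'i \<Rightarrow> 'v set" and le :: "'i \<Rightarrow> 'v rel"
    and p :: nat and Xs :: "('i \<Rightarrow> 'v) set" and A :: "('i \<Rightarrow> 'v) \<Rightarrow> nat"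
  assumes "finite N"
    and "\<And>i. i \<in> N \<Longrightarrow> linear_order_on (X i) (le i)"
    and "\<And>i. i \<in> N \<Longrightarrow> X i \<noteq> {}"
    and "p \<ge> 1"
    and "finite Xs" and "Xs \<subseteq> Pi\<^sub>E N X"
    and "A \<in> Xs \<rightarrow> {..<p}"
  shows "(u_ncs_representable N X le p Xs A \<longrightarrow> satisfiable (phi_sat N le p Xs A)) \<and>
    ((p \<ge> 3 \<longrightarrow> headroom N X le Xs) \<longrightarrow>
      (u_ncs_representable N X le p Xs A \<longleftrightarrow> satisfiable (phi_sat N le p Xs A)))"
proof -
  have "trans (le i)" if "i \<in> N" for i
    using assms(2)[OF that] by (simp add: order_on_defs)
  then show ?thesis
    using satisfiable_if_representable[OF _ assms(7)]
      representable_if_satisfiable[OF assms(2,3,5,6,7)] by blast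
qed

end
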